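(* Let $n\ge1$ and let $\mathbb{F}$ be a field with $\mathrm{char}(\mathbb{F})>n$. Suppose that $\beta\in\mathbb{F}\setminus\{0,\ldots,n\}$. Let $f\in\mathbb{F}[x_1,\ldots,x_n]$ be a polynomial such that $$f(\overline{x})\left(\sum_{i=1}^n x_i-\beta\right)\equiv 1 \mod (x_1^2-x_1,\ldots,x_n^2-x_n).$$ Then $\deg f\ge n$.
   Context: $\deg$ is total degree. The integers $0,\ldots,n$ are viewed as elements of $\mathbb{F}$. The congruence is modulo the ideal generated by $x_1^2-x_1,\ldots,x_n^2-x_n$; equivalently $f(\overline{x})=1/(\sum_ix_i-\beta)$ for all $\overline{x}\in\{0,1\}^n$. Convention: $\mathrm{char}(\mathbb{F})>n$ includes characteristic zero. *)

theory Defs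
  imports Complex_Main "HOL-Library.Poly_Mapping" "HOL-Library.Cardinality"
begin

text \<open>
  The polynomial ring over the coefficient type \<open>'a\<close> in variables indexed by \<open>'n\<close>: finitely supported
  maps from exponent vectors to coefficients, multiplied by convolution. For a finite index type
  \<open>'n\<close> this is the polynomial ring in \<open>n = CARD('n)\<close> variables.
\<close>

type_synonym ('n, 'a) mpolynomial = "('n \<Rightarrow>\<^sub>0 nat) \<Rightarrow>\<^sub>0 'a"

definition Const :: "'a::zero \<Rightarrow> ('n, 'a) mpolynomial"
  where "Const c = Poly_Mapping.single 0 c"

definition Var :: "'n \<Rightarrow> ('n, 'a::zero_neq_one) mpolynomial"
  where "Var i = Poly_Mapping.single (Poly_Mapping.single i 1) 1"

text \<open>The zero polynomial gets total degree \<open>0\<close>.\<close>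

definition total_degree :: "('n, 'a::zero) mpolynomial \<Rightarrow> nat"
  where "total_degree p =
    Max (insert 0 ((\<lambda>m. \<Sum>i\<in>Poly_Mapping.keys m. Poly_Mapping.lookup m i) ` Poly_Mapping.keys p))"

text \<open>
  A commutative ring is a module over itself, and its submodules are exactly its ideals; so the
  ideal generated by a set is its span with multiplication as scaling.
\<close>

lemma module_self: "module ((*) :: 'r::comm_ring_1 \<Rightarrow> 'r \<Rightarrow> 'r)"
  by unfold_locales (simp_all add: algebra_simps)

definition ideal_generated :: "'r::comm_ring_1 set \<Rightarrow> 'r set"
  where "ideal_generated S = module.span (*) S"

definition cong_mod_ideal :: "'r::comm_ring_1 \<Rightarrow> 'r \<Rightarrow> 'r set \<Rightarrow> bool"
  where "cong_mod_ideal p q I \<longleftrightarrow> p - q \<in> I"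

end

theory Submission
  imports Defs
begin

text \<open>
  Evaluating at the indicator vector of \<open>S\<close> gives \<open>f(1\<^sub>S) = 1 / (|S| - \<beta>)\<close>. The functional
  \<open>f \<mapsto> \<Sum>\<^sub>S (-1)\<^bsup>|S|\<^esup> f(1\<^sub>S)\<close> kills every monomial that misses some variable, hence every polynomial
  of degree less than \<open>n\<close>. On \<open>1 / (|S| - \<beta>)\<close>, however, it takes the value
  \<open>n! / \<Prod>\<^sub>k (k - \<beta>)\<close>, where \<open>k\<close> runs from \<open>0\<close> to \<open>n\<close>, by partial fractions, and \<open>n! \<noteq> 0\<close>
  in the field since its characteristic is \<open>0\<close> or exceeds \<open>n\<close>.
\<close>

text \<open>Updating at a fresh key amounts to adding a single term. This lets additivity reduce the
  multiplicativity of \<open>evaluate\<close> to monomials.\<close>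

lemma poly_mapping_add_induct [case_names zero single add]:
  fixes p :: "'k \<Rightarrow>\<^sub>0 'a::comm_monoid_add"
  assumes "P 0"
    and "\<And>k a. P (Poly_Mapping.single k a)"
    and add: "\<And>p q. P p \<Longrightarrow> P q \<Longrightarrow> P (p + q)"
  shows "P p"
proof (induction p rule: update_induct)
  case const
  show ?case by fact
next
  case (update p k a)
  then have "Poly_Mapping.update k a p = Poly_Mapping.single k a + p"
    by (intro poly_mapping_eqI)
      (auto simp: lookup_update lookup_add lookup_single not_in_keys_iff_lookup_eq_zero)
  with update assms show ?case by simp
qed

text \<open>Absent variables contribute \<open>v i ^ 0 = 1\<close>, so the product can range over
  \<open>UNIV\<close>, and monomials multiply without comparing supports.\<close>

definition evaluate :: "('n::finite \<Rightarrow> 'a) \<Rightarrow> ('n, 'a) mpolynomial \<Rightarrow> 'a::comm_ring_1"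
  where "evaluate v p =
    (\<Sum>m\<in>Poly_Mapping.keys p. Poly_Mapping.lookup p m * (\<Prod>i\<in>UNIV. v i ^ Poly_Mapping.lookup m i))"

lemma evaluate_single:
  "evaluate v (Poly_Mapping.single m a) = a * (\<Prod>i\<in>UNIV. v i ^ Poly_Mapping.lookup m i)"
  by (simp add: evaluate_def)

lemma evaluate_0 [simp]: "evaluate v 0 = 0"
  by (simp add: evaluate_def)

lemma evaluate_1 [simp]: "evaluate v 1 = 1"
  by (simp add: evaluate_single flip: single_one)

lemma evaluate_Const [simp]: "evaluate v (Const c) = c"
  by (simp add: Const_def evaluate_single)

lemma evaluate_Var [simp]: "evaluate v (Var i) = v i"
proof -
  have "(\<Prod>j\<in>UNIV. v j ^ Poly_Mapping.lookup (Poly_Mapping.single i 1) j) =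
      (\<Prod>j\<in>UNIV. if j = i then v i else 1)"
    by (intro prod.cong) (auto simp: lookup_single when_def)
  then show ?thesis
    by (simp add: Var_def evaluate_single)
qed

lemma evaluate_add [simp]: "evaluate v (p + q) = evaluate v p + evaluate v q"
  unfolding evaluate_def
  by (rule setsum_keys_plus_distrib) (simp_all add: algebra_simps)

lemma evaluate_diff [simp]: "evaluate v (p - q) = evaluate v p - evaluate v q"
  using evaluate_add[of v "p - q" q] by (simp add: algebra_simps)

lemma evaluate_sum [simp]: "evaluate v (sum p A) = (\<Sum>i\<in>A. evaluate v (p i))"
  by (induction A rule: infinite_finite_induct) simp_all

lemma evaluate_mult [simp]: "evaluate v (p * q) = evaluate v p * evaluate v q"
proof (induction p rule: poly_mapping_add_induct)
  case (single k a)
  show ?case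
  proof (induction q rule: poly_mapping_add_induct)
    case (single l b)
    show ?case
      by (simp add: mult_single evaluate_single lookup_add power_add prod.distrib)
  qed (simp_all add: algebra_simps)
qed (simp_all add: algebra_simps)

text \<open>The kernel of evaluation at a point is an ideal.\<close>

lemma evaluate_ideal_generated:
  fixes p :: "('n::finite, 'a::comm_ring_1) mpolynomial"
  assumes "p \<in> ideal_generated S" and "\<And>q. q \<in> S \<Longrightarrow> evaluate v q = 0"
  shows "evaluate v p = 0"
proof -
  interpret module "(*) :: ('n, 'a) mpolynomial \<Rightarrow> _"
    by (rule module_self)
  show ?thesis
    using assms(1) unfolding ideal_generated_def
    by (induction rule: span_induct_alt) (simp_all add: assms(2))
qed

text \<open>Each variable in the support of \<open>m\<close> has exponent at least 1.\<close>

lemma card_keys_le_total_degree: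
  assumes "m \<in> Poly_Mapping.keys p"
  shows "card (Poly_Mapping.keys m) \<le> total_degree p"
proof -
  have "card (Poly_Mapping.keys m) \<le> (\<Sum>i\<in>Poly_Mapping.keys m. Poly_Mapping.lookup m i)"
    unfolding card_eq_sum by (intro sum_mono) (simp add: in_keys_iff Suc_le_eq)
  also have "\<dots> \<le> total_degree p"
    unfolding total_degree_def using assms by (intro Max_ge) auto
  finally show ?thesis .
qed

text \<open>Since \<open>0 ^ 0 = 1\<close>, a factor vanishes exactly when its variable occurs in
  \<open>m\<close> but lies outside \<open>S\<close>.\<close>

lemma prod_indicator_power:
  fixes m :: "'n::finite \<Rightarrow>\<^sub>0 nat"
  shows "(\<Prod>i\<in>UNIV. (of_bool (i \<in> S) :: 'a::comm_semiring_1) ^ Poly_Mapping.lookup m i) =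
    of_bool (Poly_Mapping.keys m \<subseteq> S)"
proof (cases "Poly_Mapping.keys m \<subseteq> S")
  case True
  then have "(of_bool (i \<in> S) :: 'a) ^ Poly_Mapping.lookup m i = 1" for i
    by (cases "i \<in> Poly_Mapping.keys m") (auto simp: not_in_keys_iff_lookup_eq_zero)
  with True show ?thesis by simp
next
  case False
  then obtain i where "Poly_Mapping.lookup m i \<noteq> 0" "i \<notin> S"
    by (auto simp: in_keys_iff)
  then have "(\<Prod>i\<in>UNIV. (of_bool (i \<in> S) :: 'a) ^ Poly_Mapping.lookup m i) = 0"
    by (subst prod.remove[of _ i]) (simp_all add: zero_power)
  with False show ?thesis by simp
qed

text \<open>Pairing \<open>S\<close> with \<open>insert a S\<close> serves both the sign
  cancellation and the induction in \<open>alternating_sum_inverse\<close>.\<close>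

lemma sum_Pow_insert:
  assumes "finite A" "a \<notin> A"
  shows "sum g (Pow (insert a A)) = (\<Sum>S\<in>Pow A. g S + g (insert a S))"
proof -
  have "inj_on (insert a) (Pow A)"
    using assms by (auto intro!: inj_onI dest: insert_ident[THEN iffD1, rotated 2])
  moreover have "Pow A \<inter> insert a ` Pow A = {}"
    using assms by auto
  ultimately show ?thesis
    using assms by (simp add: Pow_insert sum.union_disjoint sum.reindex sum.distrib)
qed

text \<open>Toggling an element outside \<open>K\<close> flips the sign and preserves
  \<open>K \<subseteq> S\<close>.\<close>

lemma alternating_sum_supersets:
  fixes K :: "'n::finite set"
  assumes "K \<noteq> UNIV"
  shows "(\<Sum>S\<in>UNIV. (-1) ^ card S * of_bool (K \<subseteq> S)) = (0 :: 'a::ring_1)"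
proof -
  obtain a where a: "a \<notin> K"
    using assms by auto
  have "(\<Sum>S\<in>Pow (insert a (- {a})). (-1) ^ card S * of_bool (K \<subseteq> S)) = (0 :: 'a)"
  proof (subst sum_Pow_insert)
    have "(-1) ^ card (insert a S) * of_bool (K \<subseteq> insert a S) =
        - ((-1) ^ card S * of_bool (K \<subseteq> S) :: 'a)" if "S \<in> Pow (- {a})" for S
    proof -
      have "a \<notin> S" "K \<subseteq> insert a S \<longleftrightarrow> K \<subseteq> S"
        using that a by auto
      then show ?thesis by simp
    qed
    then show "(\<Sum>S\<in>Pow (- {a}). (-1) ^ card S * of_bool (K \<subseteq> S) +
        (-1) ^ card (insert a S) * of_bool (K \<subseteq> insert a S)) = (0 :: 'a)"
      by (intro sum.neutral) simp
  qed simp_all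
  moreover have "insert a (- {a}) = UNIV"
    by auto
  ultimately show ?thesis
    by simp
qed

text \<open>After swapping the sums, each monomial contributes an alternating sum over the supersets
  of its support, which is too small to be \<open>UNIV\<close>.\<close>

lemma alternating_sum_evaluate:
  fixes p :: "('n::finite, 'a::comm_ring_1) mpolynomial"
  assumes "total_degree p < CARD('n)"
  shows "(\<Sum>S\<in>UNIV. (-1) ^ card S * evaluate (\<lambda>i. of_bool (i \<in> S)) p) = 0"
proof -
  have "(\<Sum>S\<in>UNIV. (-1) ^ card S * evaluate (\<lambda>i. of_bool (i \<in> S)) p) =
      (\<Sum>m\<in>Poly_Mapping.keys p. Poly_Mapping.lookup p m *
        (\<Sum>S\<in>UNIV. (-1) ^ card S * of_bool (Poly_Mapping.keys m \<subseteq> S)))"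
    unfolding evaluate_def prod_indicator_power sum_distrib_left
    by (subst sum.swap) (simp only: mult.left_commute)
  also have "\<dots> = 0"
  proof (intro sum.neutral ballI)
    fix m assume "m \<in> Poly_Mapping.keys p"
    then have *: "Poly_Mapping.keys m \<noteq> UNIV"
      using card_keys_le_total_degree[of m p] assms by auto
    show "Poly_Mapping.lookup p m *
        (\<Sum>S\<in>UNIV. (-1) ^ card S * of_bool (Poly_Mapping.keys m \<subseteq> S)) = 0"
      by (simp only: alternating_sum_supersets[OF *] mult_zero_right)
  qed
  finally show ?thesis .
qed

text \<open>This is the iterated finite difference of \<open>1 / x\<close>. A new element of
  \<open>A\<close> subtracts the sum at \<open>x + 1\<close> from the sum at \<open>x\<close>, so
  \<open>x\<close> must vary in the induction. The factorial is cast from \<open>nat\<close> because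
  the field may have positive characteristic.\<close>

lemma alternating_sum_inverse:
  fixes x :: "'a::field"
  assumes "finite A" and "pochhammer x (Suc (card A)) \<noteq> 0"
  shows "(\<Sum>S\<in>Pow A. (-1) ^ card S / (x + of_nat (card S))) =
    of_nat (fact (card A)) / pochhammer x (Suc (card A))"
  using assms
proof (induction A arbitrary: x rule: finite_induct)
  case empty
  then show ?case by simp
next
  case (insert a A)
  define n where "n = card A"
  \<comment> \<open>\<open>P\<close> is the part shared by the denominators \<open>x * P\<close> at
    \<open>x\<close> and \<open>P * y\<close> at \<open>x + 1\<close>.\<close>
  define P where "P = pochhammer (x + 1) n"
  define y where "y = x + 1 + of_nat n"
  have card: "card (insert a A) = Suc n"
    using insert.hyps by (simp add: n_def)
  have P1: "pochhammer (x + 1) (Suc n) = P * y"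
    by (simp add: pochhammer_Suc P_def y_def)
  have P0: "pochhammer x (Suc n) = x * P"
    by (simp add: pochhammer_rec P_def)
  have P2: "pochhammer x (Suc (Suc n)) = x * (P * y)"
    by (subst pochhammer_rec) (simp add: P1)
  have nz: "x \<noteq> 0" "P \<noteq> 0" "y \<noteq> 0"
    using insert.prems P2 by (auto simp: card)
  have "(\<Sum>S\<in>Pow (insert a A). (-1) ^ card S / (x + of_nat (card S))) =
      (\<Sum>S\<in>Pow A. (-1) ^ card S / (x + of_nat (card S)) -
        (-1) ^ card S / (x + 1 + of_nat (card S)))"
    unfolding sum_Pow_insert[OF insert.hyps]
  proof (rule sum.cong[OF refl])
    fix S assume "S \<in> Pow A"
    then have "finite S" "a \<notin> S"
      using insert.hyps finite_subset by auto
    then show "(-1) ^ card S / (x + of_nat (card S)) +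
        (-1) ^ card (insert a S) / (x + of_nat (card (insert a S))) =
        (-1) ^ card S / (x + of_nat (card S)) - (-1) ^ card S / (x + 1 + of_nat (card S))"
      by (simp add: add.assoc)
  qed
  also have "\<dots> = of_nat (fact n) / (x * P) - of_nat (fact n) / (P * y)"
    using insert.IH[of x] insert.IH[of "x + 1"] nz P0 P1
    by (simp add: sum_subtractf flip: n_def)
  also have "\<dots> = of_nat (fact n) * (y - x) / (x * (P * y))"
    using nz by (simp add: field_simps)
  \<comment> \<open>The difference \<open>y - x\<close> is \<open>n + 1\<close>, the next factor of
    the factorial.\<close>
  also have "of_nat (fact n) * (y - x) = of_nat (fact (Suc n))"
    by (simp add: y_def algebra_simps)
  finally show ?case
    by (simp only: card P2)
qed

text \<open>The characteristic divides none of the factors \<open>1, ..., n\<close>.\<close>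

lemma of_nat_fact_neq_0_CHAR:
  assumes "CHAR('a::idom) = 0 \<or> CHAR('a) > n"
  shows "(of_nat (fact n) :: 'a) \<noteq> 0"
  using assms
proof (induction n)
  case (Suc n)
  have "of_nat (Suc n) \<noteq> (0 :: 'a)"
    using Suc.prems by (auto simp only: of_nat_eq_0_iff_char_dvd dest: dvd_imp_le)
  moreover have "of_nat (fact n) \<noteq> (0 :: 'a)"
    using Suc by auto
  ultimately show ?case
    by (simp only: fact_Suc of_nat_mult of_nat_id mult_eq_0_iff) simp
qed simp

theorem corollary5p4:
  fixes \<beta> :: "'a::field"
    and f :: "('n::finite, 'a) mpolynomial"
  assumes "CHAR('a) = 0 \<or> CHAR('a) > CARD('n)"
    and "\<beta> \<notin> of_nat ` {0..CARD('n)}"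
    and "cong_mod_ideal (f * ((\<Sum>i\<in>UNIV. Var i) - Const \<beta>)) 1
           (ideal_generated (range (\<lambda>i. Var i ^ 2 - Var i)))"
  shows "total_degree f \<ge> CARD('n)"
proof (rule ccontr)
  assume "\<not> total_degree f \<ge> CARD('n)"
  then have deg: "total_degree f < CARD('n)"
    by simp
  have value_at: "evaluate (\<lambda>i. of_bool (i \<in> S)) f = 1 / (- \<beta> + of_nat (card S))" for S :: "'n set"
  proof -
    let ?v = "\<lambda>i. of_bool (i \<in> S) :: 'a"
    \<comment> \<open>The generators vanish at \<open>?v\<close> because 0 and 1 are
      idempotent.\<close>
    have "evaluate ?v (f * ((\<Sum>i\<in>UNIV. Var i) - Const \<beta>) - 1) = 0"
      using assms(3) unfolding cong_mod_ideal_def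
      by (rule evaluate_ideal_generated) (auto simp: power2_eq_square)
    moreover have "(\<Sum>i\<in>UNIV. ?v i) = of_nat (card S)"
      by (simp add: of_bool_def flip: sum.inter_filter)
    ultimately have "evaluate ?v f * (- \<beta> + of_nat (card S)) = 1"
      by simp
    \<comment> \<open>A product equal to 1 has nonzero factors, so division is legitimate.\<close>
    then show ?thesis
      by (metis mult_zero_right nonzero_eq_divide_eq zero_neq_one)
  qed
  \<comment> \<open>Its factors are \<open>k - \<beta>\<close> for \<open>k\<close> from 0 to
    \<open>CARD('n)\<close>, all nonzero by the choice of \<open>\<beta>\<close>.\<close>
  have "pochhammer (- \<beta>) (Suc CARD('n)) \<noteq> 0"
    using assms(2) by (auto simp: pochhammer_Suc_prod add_eq_0_iff)
  moreover from this have
    "of_nat (fact CARD('n)) / pochhammer (- \<beta>) (Suc CARD('n)) =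
      (\<Sum>S\<in>(UNIV :: 'n set set). (-1) ^ card S * evaluate (\<lambda>i. of_bool (i \<in> S)) f)"
    by (subst alternating_sum_inverse[OF finite, symmetric]) (simp_all add: value_at)
  ultimately show False
    using alternating_sum_evaluate[OF deg] of_nat_fact_neq_0_CHAR[OF assms(1)] by simp
qed

end
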